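(* Let $\mathbb{F}_{q^t}$ be a subfield of $\mathbb{F}_{q^n}$ with $1<t<n$ and write $n=t\ell$. There exist $\mathbb{F}_q$-linear sets of rank $k$ in $\mathrm{PG}(1,q^n)$ with one point of weight $t$, one point of weight $s$ and all other points of weight one, for the following values of $n,k,s$: (a) $n$ even, $k=t+s$, and any $s\in\{1,\dots,\frac n2\}$; (b) $n$ odd, $k=t+s$, and any $s\in\{1,\dots,\frac{n-t}{2}\}$. In particular, if $n$ is even and $t=\frac n2$, there exist $\mathbb{F}_q$-linear sets of rank $n$ in $\mathrm{PG}(1,q^n)$ with exactly two points of weight greater than one, both of weight $\frac n2$.
   Context: An $\mathbb{F}_q$-linear set of rank $k$ in $\mathrm{PG}(1,q^n)$ is $L_U=\{\langle \mathbf u\rangle_{\mathbb{F}_{q^n}}\colon \mathbf u\in U\setminus\{\mathbf 0\}\}$ for a $k$-dimensional $\mathbb{F}_q$-subspace $U$ of $\mathbb{F}_{q^n}^2$; the weight of a point $\langle\mathbf v\rangle_{\mathbb{F}_{q^n}}$ in $L_U$ is $\dim_{\mathbb{F}_q}(U\cap\langle\mathbf v\rangle_{\mathbb{F}_{q^n}})$. *)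

theory Defs
  imports Complex_Main "HOL-Library.Product_Plus" "HOL-Library.Cardinality"
begin

text \<open>
  Throughout, \<open>'q\<close> is the field of order q, \<open>'f\<close> the field of order \<open>q ^ n\<close>, and \<open>\<phi>\<close> is the inclusion of
  the former in the latter (a homomorphism of fields preserving 1, hence injective).
\<close>

definition field_embedding :: "('q::field \<Rightarrow> 'f::field) \<Rightarrow> bool" where
  "field_embedding \<phi> \<longleftrightarrow>
     \<phi> 1 = 1 \<and> (\<forall>x y. \<phi> (x + y) = \<phi> x + \<phi> y) \<and> (\<forall>x y. \<phi> (x * y) = \<phi> x * \<phi> y)"

definition is_subfield :: "'f::field set \<Rightarrow> bool" where
  "is_subfield K \<longleftrightarrow> 0 \<in> K \<and> 1 \<in> K \<and>
     (\<forall>x\<in>K. \<forall>y\<in>K. x + y \<in> K \<and> x * y \<in> K) \<and> (\<forall>x\<in>K. - x \<in> K \<and> inverse x \<in> K)"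

definition scale2 :: "('q \<Rightarrow> 'f) \<Rightarrow> 'q \<Rightarrow> 'f \<times> 'f \<Rightarrow> ('f::field) \<times> 'f" where
  "scale2 \<phi> c v = (\<phi> c * fst v, \<phi> c * snd v)"

lemma vector_space_scale2: "field_embedding \<phi> \<Longrightarrow> vector_space (scale2 \<phi>)"
  by unfold_locales (auto simp: field_embedding_def scale2_def algebra_simps)

text \<open>With \<open>\<phi> = id\<close>, \<open>scale2\<close> is the ordinary scalar multiplication of the plane over \<open>'f\<close>.\<close>

definition proj_point :: "('f::field) \<times> 'f \<Rightarrow> ('f \<times> 'f) set" where
  "proj_point v = module.span (scale2 id) {v}"

lemma proj_point_eq: "proj_point v = {(a * fst v, a * snd v) | a. True}"
proof -
  interpret vector_space "scale2 (id :: 'f::field \<Rightarrow> 'f)"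
    by (rule vector_space_scale2) (simp add: field_embedding_def)
  show ?thesis
    unfolding proj_point_def span_singleton by (auto simp: scale2_def)
qed

definition linear_set :: "(('f::field) \<times> 'f) set \<Rightarrow> ('f \<times> 'f) set set" where
  "linear_set U = {proj_point u | u. u \<in> U - {0}}"

definition Fq_subspace_of_dim ::
  "('q::field \<Rightarrow> 'f::field) \<Rightarrow> nat \<Rightarrow> ('f \<times> 'f) set \<Rightarrow> bool" where
  "Fq_subspace_of_dim \<phi> k U \<longleftrightarrow>
     module.subspace (scale2 \<phi>) U \<and> vector_space.dim (scale2 \<phi>) U = k"

text \<open>The weight of a point of \<open>linear_set U\<close> depends on the subspace \<open>U\<close>, not only on the set
  of points it determines.\<close>

definition weight ::
  "('q::field \<Rightarrow> 'f::field) \<Rightarrow> ('f \<times> 'f) set \<Rightarrow> ('f \<times> 'f) set \<Rightarrow> nat" where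
  "weight \<phi> U P = vector_space.dim (scale2 \<phi>) (U \<inter> P)"

definition exists_linear_set_with_weights :: "('q::field \<Rightarrow> 'f::field) \<Rightarrow> nat \<Rightarrow> nat \<Rightarrow> nat \<Rightarrow> bool" where
  "exists_linear_set_with_weights \<phi> k t s \<longleftrightarrow>
     (\<exists>U. Fq_subspace_of_dim \<phi> k U \<and>
       (\<exists>P\<in>linear_set U. \<exists>Q\<in>linear_set U. P \<noteq> Q \<and> weight \<phi> U P = t \<and> weight \<phi> U Q = s \<and>
         (\<forall>R\<in>linear_set U - {P, Q}. weight \<phi> U R = 1)))"

end

(* Take U = A x B, where A is a t-dimensional subspace of a subfield L of order q^d and B is
   scattered with respect to L, meaning that c b \<in> B with c \<in> L and 0 \<noteq> b \<in> B forces c \<in> F_q.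
   The points <(1,0)> and <(0,1)> then have weights t and dim B; a point <(x,y)> of the linear set
   with x, y \<noteq> 0 has weight one, because (c x, c y) \<in> U gives c \<in> L and hence c \<in> F_q.
   If a_1, b_1, ..., a_r, b_r are independent over L, the sums of x_i a_i + x_i^q b_i (x_i \<in> L)
   form a scattered subspace of dimension d r. For n even, L is the subfield of order q^(n/2) and
   r = 1; for n odd, L = K and r = (l - 1)/2. *)

theory Submission
  imports Defs "HOL-Computational_Algebra.Polynomial"
begin

section \<open>Subspaces over a subfield of the scalars\<close>

text \<open>A locale of its own, because declarations in \<open>vector_space\<close> would be shadowed by their instances
  for \<open>real_vector\<close>.\<close>

locale field_vector_space = vector_space scale
  for scale :: "'a::field \<Rightarrow> 'b::ab_group_add \<Rightarrow> 'b"
begin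

text \<open>The scalars form a subset of a field, so that one notion covers F_q, the subfield
  \<open>L\<close> and, with \<open>K = UNIV\<close>, the full scalar field.\<close>

definition subspace_over :: "'a set \<Rightarrow> 'b set \<Rightarrow> bool" where
  "subspace_over K V \<longleftrightarrow> 0 \<in> V \<and> (\<forall>x\<in>V. \<forall>y\<in>V. x + y \<in> V) \<and> (\<forall>c\<in>K. \<forall>x\<in>V. scale c x \<in> V)"

definition adjoin :: "'a set \<Rightarrow> 'b set \<Rightarrow> 'b \<Rightarrow> 'b set" where
  "adjoin K V a = (\<lambda>(v, c). v + scale c a) ` (V \<times> K)"

lemma subspace_over_diff:
  assumes "is_subfield K" "subspace_over K V" "x \<in> V" "y \<in> V"
  shows "x - y \<in> V"
proof -
  have "scale (- 1) y \<in> V"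
    using assms unfolding is_subfield_def subspace_over_def by blast
  then have "x + scale (- 1) y \<in> V"
    using assms by (auto simp: subspace_over_def)
  then show ?thesis by simp
qed

text \<open>Otherwise \<open>(c - d) a = w - v\<close> is in \<open>V\<close>, and dividing by
  \<open>c - d\<close> within \<open>K\<close> puts \<open>a\<close> into \<open>V\<close>.\<close>

lemma adjoin_coeff_unique:
  assumes K: "is_subfield K" and V: "subspace_over K V" and a: "a \<notin> V"
    and "v \<in> V" "w \<in> V" "c \<in> K" "d \<in> K" and eq: "v + scale c a = w + scale d a"
  shows "v = w \<and> c = d"
proof -
  have "c = d"
  proof (rule ccontr)
    assume "c \<noteq> d"
    have "c + - d \<in> K"
      using K \<open>c \<in> K\<close> \<open>d \<in> K\<close> unfolding is_subfield_def by blast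
    then have "inverse (c - d) \<in> K"
      using K unfolding is_subfield_def by auto
    moreover have "w - v \<in> V"
      using subspace_over_diff[OF K V] \<open>v \<in> V\<close> \<open>w \<in> V\<close> by blast
    ultimately have "scale (inverse (c - d)) (w - v) \<in> V"
      using V unfolding subspace_over_def by blast
    moreover have "w - v = scale (c - d) a"
      using eq by (simp add: scale_left_diff_distrib algebra_simps)
    ultimately show False
      using a \<open>c \<noteq> d\<close> by simp
  qed
  with eq show ?thesis by simp
qed

lemma card_adjoin:
  assumes "is_subfield K" "subspace_over K V" "a \<notin> V"
  shows "card (adjoin K V a) = card V * card K"
proof -
  have "inj_on (\<lambda>(v, c). v + scale c a) (V \<times> K)"
    by (rule inj_onI) (use adjoin_coeff_unique[OF assms] in \<open>auto; metis\<close>)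
  then show ?thesis
    unfolding adjoin_def by (simp add: card_image card_cartesian_product)
qed

lemma adjoinI: "v \<in> V \<Longrightarrow> c \<in> K \<Longrightarrow> v + scale c a \<in> adjoin K V a"
  by (auto simp: adjoin_def)

lemma subspace_over_adjoin:
  assumes K: "is_subfield K" and V: "subspace_over K V"
  shows "subspace_over K (adjoin K V a)"
  unfolding subspace_over_def
proof (intro conjI ballI)
  show "0 \<in> adjoin K V a"
    using K V by (force simp: adjoin_def is_subfield_def subspace_over_def)
next
  fix x y assume "x \<in> adjoin K V a" "y \<in> adjoin K V a"
  then obtain v c w d where "v \<in> V" "c \<in> K" "w \<in> V" "d \<in> K"
    and xy: "x = v + scale c a" "y = w + scale d a"
    by (auto simp: adjoin_def)
  moreover from this have "v + w \<in> V" "c + d \<in> K"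
    using K V by (auto simp: is_subfield_def subspace_over_def)
  moreover have "x + y = (v + w) + scale (c + d) a"
    by (simp add: xy scale_left_distrib algebra_simps)
  ultimately show "x + y \<in> adjoin K V a"
    by (metis adjoinI)
next
  fix e x assume "e \<in> K" "x \<in> adjoin K V a"
  then obtain v c where "v \<in> V" "c \<in> K" and x: "x = v + scale c a"
    by (auto simp: adjoin_def)
  moreover from this have "scale e v \<in> V" "e * c \<in> K"
    using K V \<open>e \<in> K\<close> by (auto simp: is_subfield_def subspace_over_def)
  moreover have "scale e x = scale e v + scale (e * c) a"
    by (simp add: x scale_right_distrib)
  ultimately show "scale e x \<in> adjoin K V a"
    by (metis adjoinI)
qed

text \<open>The bridge from dimensions to counting: each basis vector multiplies the size of the
  span by the number of scalars.\<close>

lemma card_subspace_eq_power_dim: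
  assumes "subspace S" "finite S"
  shows "card S = CARD('a) ^ dim S"
proof -
  have UNIV_subfield: "is_subfield (UNIV :: 'a set)"
    by (simp add: is_subfield_def)
  have card_span: "card (span B) = CARD('a) ^ card B" if "finite B" "independent B" for B
    using that
  proof (induction B)
    case (insert b B)
    have sub: "subspace_over UNIV (span B)"
      by (simp add: subspace_over_def span_zero span_add span_scale)
    have "b \<notin> span B"
      using insert.prems insert.hyps by (simp add: independent_insert)
    moreover have "span (insert b B) = adjoin UNIV (span B) b"
    proof (intro equalityI subsetI)
      fix x assume "x \<in> span (insert b B)"
      then obtain c where "x - scale c b \<in> span B"
        by (auto simp: span_insert)
      from adjoinI[OF this UNIV_I, of c b] show "x \<in> adjoin UNIV (span B) b"
        by simp
    next
      fix x assume "x \<in> adjoin UNIV (span B) b"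
      then obtain v c where "v \<in> span B" "x = v + scale c b"
        by (auto simp: adjoin_def)
      then show "x \<in> span (insert b B)"
        by (auto simp: span_insert intro: exI[of _ c])
    qed
    moreover have "independent B"
      using insert.prems insert.hyps by (simp add: independent_insert)
    ultimately show ?case
      using insert card_adjoin[OF UNIV_subfield sub] by simp
  qed simp
  obtain B where B: "B \<subseteq> S" "independent B" "S \<subseteq> span B" "card B = dim S"
    using basis_exists by blast
  moreover have "span B = S"
    using B assms(1) span_subspace by blast
  ultimately show ?thesis
    using card_span[of B] assms(2) finite_subset by fastforce
qed

end

text \<open>Since \<open>subspace_over\<close> restricts the scalars, the field as a line over
  itself carries the structure over each of its subfields as well.\<close>

interpretation field_over_itself: field_vector_space "(*) :: 'f::field \<Rightarrow> 'f \<Rightarrow> 'f"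
  by unfold_locales (auto simp: algebra_simps)

section \<open>Fermat's little theorem for finite subfields\<close>

text \<open>Multiplication by \<open>x \<noteq> 0\<close> permutes \<open>L - {0}\<close>; comparing
  the products over this set gives \<open>x ^ (card L - 1) = 1\<close>.\<close>

lemma subfield_power_card_eq_same:
  fixes L :: "'a::field set"
  assumes L: "is_subfield L" and "finite L" and "x \<in> L"
  shows "x ^ card L = x"
proof (cases "x = 0")
  case True
  have "0 \<in> L" using L by (simp add: is_subfield_def)
  then show ?thesis using True \<open>finite L\<close> by (auto simp: power_0_left)
next
  case False
  have "0 \<in> L" using L by (simp add: is_subfield_def)
  have "(\<Prod>y\<in>L-{0}. x * y) = (\<Prod>y\<in>L-{0}. y)"
    by (rule prod.reindex_bij_witness[of _ "\<lambda>y. inverse x * y" "\<lambda>y. x * y"])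
      (use False L \<open>x \<in> L\<close> in \<open>auto simp: is_subfield_def\<close>)
  then have "x ^ (card L - 1) * \<Prod>(L-{0}) = 1 * \<Prod>(L-{0})"
    using \<open>finite L\<close> \<open>0 \<in> L\<close> by (simp add: prod.distrib)
  then have "x ^ (card L - 1) = 1"
    by (subst (asm) mult_right_cancel) (use \<open>finite L\<close> in auto)
  moreover have "card L > 0"
    using \<open>finite L\<close> \<open>0 \<in> L\<close> by (auto simp: card_gt_0_iff)
  ultimately show ?thesis
    by (metis power_minus_mult mult_1)
qed

lemma power_card_eq_same:
  fixes x :: "'a::{field,finite}"
  shows "x ^ CARD('a) = x"
  by (rule subfield_power_card_eq_same) (auto simp: is_subfield_def)

section \<open>The Frobenius map\<close>

locale finite_field_extension =
  fixes \<phi> :: "'q::{field,finite} \<Rightarrow> 'f::{field,finite}"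
    and q :: nat
  assumes embedding: "field_embedding \<phi>"
    and order: "CARD('q) = q"
begin

lemma emb_add: "\<phi> (x + y) = \<phi> x + \<phi> y"
  and emb_mult: "\<phi> (x * y) = \<phi> x * \<phi> y"
  and emb_one [simp]: "\<phi> 1 = 1"
  using embedding by (auto simp: field_embedding_def)

lemma emb_zero [simp]: "\<phi> 0 = 0"
  by (metis add_0_left add_cancel_right_left emb_add)

lemma emb_uminus: "\<phi> (- x) = - \<phi> x"
  using emb_add[of x "- x"] by (simp add: eq_neg_iff_add_eq_0 add.commute)

lemma emb_eq_0_iff [simp]: "\<phi> x = 0 \<longleftrightarrow> x = 0"
  using emb_mult[of x "inverse x"] by (cases "x = 0") auto

lemma inj_emb: "inj \<phi>"
proof (rule injI)
  fix x y assume "\<phi> x = \<phi> y"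
  then have "\<phi> (x + - y) = 0"
    by (simp only: emb_add emb_uminus) simp
  then show "x = y" by simp
qed

lemma emb_inverse: "\<phi> (inverse x) = inverse (\<phi> x)"
  using emb_mult[of x "inverse x"] by (cases "x = 0") (auto simp: inverse_unique)

lemma emb_of_nat: "\<phi> (of_nat k) = of_nat k"
  by (induction k) (simp_all add: emb_add)

lemma emb_power: "\<phi> (x ^ k) = \<phi> x ^ k"
  by (induction k) (simp_all add: emb_mult)

abbreviation "F\<^sub>q \<equiv> range \<phi>"

lemma is_subfield_base: "is_subfield F\<^sub>q"
  unfolding is_subfield_def
  by (auto simp: emb_add[symmetric] emb_mult[symmetric] emb_uminus[symmetric]
      emb_inverse[symmetric] intro: range_eqI[of _ _ 0] range_eqI[of _ _ 1])

lemma card_base: "card F\<^sub>q = q"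
  using card_image[OF inj_emb] order by simp

lemma power_q_eq_same: "(x :: 'q) ^ q = x"
  using power_card_eq_same[of x] order by simp

lemma q_gt_1: "q > 1"
proof -
  have "card {0, 1 :: 'q} \<le> CARD('q)" by (rule card_mono) auto
  then show ?thesis using order by simp
qed

text \<open>The polynomial \<open>(X + 1)\<^sup>q - X\<^sup>q - 1\<close> has degree less than \<open>q\<close> and vanishes on \<open>'q\<close>.\<close>

lemma of_nat_binomial_eq_0:
  assumes "0 < k" "k < q"
  shows "of_nat (q choose k) = (0 :: 'q)"
proof -
  define p :: "'q poly" where "p = (\<Sum>k\<in>{0<..<q}. monom (of_nat (q choose k)) k)"
  have "poly p x = 0" for x
  proof -
    have "x + 1 = (x + 1) ^ q"
      by (simp add: power_q_eq_same)
    also have "\<dots> = (\<Sum>k\<le>q. of_nat (q choose k) * x ^ k)"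
      by (simp add: binomial_ring)
    also have "{..q} = insert 0 (insert q {0<..<q})"
      using q_gt_1 by auto
    also have "(\<Sum>k\<in>\<dots>. of_nat (q choose k) * x ^ k) = 1 + (x ^ q + poly p x)"
      using q_gt_1 by (simp add: p_def poly_sum poly_monom)
    finally show ?thesis
      by (simp add: power_q_eq_same)
  qed
  moreover have "degree p < q"
    unfolding p_def using q_gt_1
    by (intro degree_sum_less) (auto intro: le_less_trans[OF degree_monom_le])
  ultimately have "p = 0"
    using card_poly_roots_bound[of p] order by auto
  then have "coeff p k = 0" by simp
  then show ?thesis
    using assms by (simp add: p_def coeff_sum sum.delta)
qed

text \<open>Only the end terms of the binomial expansion survive: the inner coefficients vanish in
  \<open>'q\<close>, and \<open>\<phi>\<close> carries this over to \<open>'f\<close>.\<close>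

lemma frobenius_add: "(x + y :: 'f) ^ q = x ^ q + y ^ q"
proof -
  have zero: "of_nat (q choose k) = (0 :: 'f)" if "k \<in> {0<..<q}" for k
    using of_nat_binomial_eq_0[of k] that emb_of_nat[of "q choose k"] by simp
  have "(x + y) ^ q = (\<Sum>k\<le>q. of_nat (q choose k) * x ^ k * y ^ (q - k))"
    by (rule binomial_ring)
  also have "{..q} = insert 0 (insert q {0<..<q})"
    using q_gt_1 by auto
  also have "(\<Sum>k\<in>\<dots>. of_nat (q choose k) * x ^ k * y ^ (q - k)) = y ^ q + x ^ q"
    using q_gt_1 by (simp add: zero)
  finally show ?thesis by simp
qed

lemma frobenius_power_add: "(x + y :: 'f) ^ (q ^ d) = x ^ (q ^ d) + y ^ (q ^ d)"
  by (induction d) (simp_all add: power_mult frobenius_add mult.commute[of q])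

section \<open>Fixed fields of power maps, by counting roots\<close>

text \<open>One bound for the fixed points of a power map (\<open>b = - 1\<close>,
  \<open>c = 0\<close>) and for the fibres of a trace (\<open>b = 1\<close>). With
  \<open>m > 1\<close> the polynomial is monic of degree \<open>m\<close>.\<close>

lemma card_roots_trinomial:
  fixes b c :: 'f
  assumes "m > 1"
  shows "card {x. x ^ m + b * x + c = 0} \<le> m"
proof -
  let ?p = "monom 1 m + [:c, b:]"
  have "degree [:c, b:] < m" using assms by (simp add: degree_pCons_eq_if)
  then have deg: "degree ?p = m"
    by (subst degree_add_eq_left) (auto simp: degree_monom_eq)
  then have "?p \<noteq> 0" using assms by (metis degree_0 not_less_zero zero_less_one)
  then have "card {x. poly ?p x = 0} \<le> degree ?p"
    by (rule card_poly_roots_bound)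
  also have "{x. poly ?p x = 0} = {x. x ^ m + b * x + c = 0}"
    by (simp add: poly_monom algebra_simps)
  finally show ?thesis using deg by simp
qed

text \<open>F_q consists of roots of X^q - X and has q elements, as many as that polynomial can have
  roots.\<close>

lemma mem_base_iff: "x \<in> F\<^sub>q \<longleftrightarrow> x ^ q = x"
proof -
  have "F\<^sub>q = {x. x ^ q + (- 1) * x + 0 = 0}"
  proof (rule card_seteq)
    show "F\<^sub>q \<subseteq> {x. x ^ q + (- 1) * x + 0 = 0}"
      by (auto simp: emb_power[symmetric] power_q_eq_same)
    show "card {x :: 'f. x ^ q + (- 1) * x + 0 = 0} \<le> card F\<^sub>q"
      unfolding card_base using q_gt_1 by (rule card_roots_trinomial)
  qed auto
  then show ?thesis by (auto simp: set_eq_iff)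
qed

text \<open>The trace \<open>x + x\<^sup>Q\<close>, \<open>Q = q ^ d\<close>, takes values in the fixed field of \<open>x \<mapsto> x\<^sup>Q\<close> and has fibres
  of size at most \<open>Q\<close>, so that field has at least \<open>Q\<close> elements.\<close>

lemma half_degree_subfield:
  assumes card: "CARD('f) = q ^ (2 * d)" and "d > 0"
  obtains L :: "'f set" where "is_subfield L" "card L = q ^ d"
proof
  let ?Q = "q ^ d"
  let ?L = "{x :: 'f. x ^ ?Q = x}"
  have Q: "?Q > 1"
    using q_gt_1 \<open>d > 0\<close> by (rule one_less_power)
  \<comment> \<open>Additivity at \<open>x + - x = 0\<close> gives the sign in every
    characteristic.\<close>
  have "(- x) ^ ?Q = - (x ^ ?Q)" for x :: 'f
    using frobenius_power_add[of x "- x" d] q_gt_1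
    by (simp add: eq_neg_iff_add_eq_0 add.commute power_0_left)
  then show "is_subfield ?L"
    using Q q_gt_1 by (auto simp: is_subfield_def frobenius_power_add power_mult_distrib power_inverse)
  let ?T = "\<lambda>x :: 'f. x + x ^ ?Q"
  \<comment> \<open>As the field has \<open>?Q ^ 2\<close> elements, the \<open>?Q\<close>-power map
    is an involution, so it swaps the two summands of the trace.\<close>
  have "x ^ ?Q ^ 2 = x" for x :: 'f
    using power_card_eq_same[of x] card by (simp add: power_mult mult.commute)
  then have "?T ` UNIV \<subseteq> ?L"
    by (auto simp: frobenius_power_add power2_eq_square power_mult[symmetric] add.commute)
  then have "UNIV = (\<Union>c\<in>?L. {x. ?T x = c})"
    by auto
  then have "CARD('f) = card (\<Union>c\<in>?L. {x. ?T x = c})"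
    by (rule arg_cong)
  also have "\<dots> \<le> (\<Sum>c\<in>?L. card {x. ?T x = c})"
    by (rule card_UN_le) simp
  also have "\<dots> \<le> (\<Sum>c\<in>?L. ?Q)"
  proof (rule sum_mono)
    fix c
    have "{x. ?T x = c} = {x. x ^ ?Q + 1 * x + (- c) = 0}"
      by (auto simp: algebra_simps)
    then show "card {x. ?T x = c} \<le> ?Q"
      using card_roots_trinomial[OF Q, of 1 "- c"] by simp
  qed
  finally have "?Q * ?Q \<le> card ?L * ?Q"
    using card by (simp add: power_add mult_2)
  then have "?Q \<le> card ?L"
    by (rule mult_right_le_imp_le) (use q_gt_1 in simp)
  moreover have "card ?L \<le> ?Q"
    using card_roots_trinomial[OF Q, of "- 1" 0] by simp
  ultimately show "card ?L = ?Q" by simp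
qed

section \<open>Scattered subspaces\<close>

abbreviation "subspace_over \<equiv> field_over_itself.subspace_over"

abbreviation "adjoin \<equiv> field_over_itself.adjoin"

text \<open>For an F_q-subspace \<open>B\<close> this says that each L-line \<open>L b\<close> with
  \<open>0 \<noteq> b \<in> B\<close> meets \<open>B\<close> in \<open>F\<^sub>q b\<close>
  only.\<close>

definition scattered :: "'f set \<Rightarrow> 'f set \<Rightarrow> bool" where
  "scattered L B \<longleftrightarrow> (\<forall>c\<in>L. \<forall>b\<in>B. b \<noteq> 0 \<longrightarrow> c * b \<in> B \<longrightarrow> c \<in> F\<^sub>q)"

text \<open>Starting from \<open>{0}\<close>, vectors of \<open>V\<close> are adjoined one at a
  time, each multiplying the size by \<open>q\<close>.\<close>

lemma subspace_of_card:
  assumes V: "subspace_over F\<^sub>q V" "card V = q ^ d" and "s \<le> d"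
  shows "\<exists>W\<subseteq>V. subspace_over F\<^sub>q W \<and> card W = q ^ s"
  using \<open>s \<le> d\<close>
proof (induction s)
  case 0
  have "{0} \<subseteq> V" "subspace_over F\<^sub>q {0}"
    using V by (auto simp: field_over_itself.subspace_over_def)
  then show ?case by (intro exI[of _ "{0}"]) simp
next
  case (Suc s)
  then obtain W where W: "W \<subseteq> V" "subspace_over F\<^sub>q W" "card W = q ^ s"
    by auto
  then have "card W < card V"
    using V Suc.prems q_gt_1 by (simp add: power_strict_increasing_iff)
  with W obtain a where a: "a \<in> V" "a \<notin> W"
    by (metis less_irrefl subsetI subset_antisym)
  have "adjoin F\<^sub>q W a \<subseteq> V"
    using V W a by (auto simp: field_over_itself.adjoin_def field_over_itself.subspace_over_def)
  moreover have "card (adjoin F\<^sub>q W a) = q ^ Suc s"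
    using field_over_itself.card_adjoin[OF is_subfield_base W(2) a(2)] W(3) card_base by simp
  ultimately show ?case
    using field_over_itself.subspace_over_adjoin[OF is_subfield_base W(2)] by blast
qed

text \<open>One grows \<open>B\<close> by the vectors \<open>x a + x\<^sup>q b\<close>, \<open>x \<in> L\<close>, with \<open>a\<close> and \<open>b\<close> independent over \<open>L\<close> modulo
  \<open>V\<close>: if \<open>y = c x\<close> and \<open>y\<^sup>q = c x\<^sup>q\<close> with \<open>x \<noteq> 0\<close>, then \<open>c\<^sup>q = c\<close>.\<close>

lemma scattered_subspace_in_span:
  assumes L: "is_subfield L" and base: "F\<^sub>q \<subseteq> L"
    and card: "CARD('f) = card L ^ m" and "2 * r \<le> m"
  shows "\<exists>V B. subspace_over L V \<and> card V = card L ^ (2 * r) \<and>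
    B \<subseteq> V \<and> subspace_over F\<^sub>q B \<and> card B = card L ^ r \<and> scattered L B"
  using \<open>2 * r \<le> m\<close>
proof (induction r)
  case 0
  then show ?case
    by (intro exI[of _ "{0}"])
      (auto simp: field_over_itself.subspace_over_def scattered_def)
next
  case (Suc r)
  then obtain V B where V: "subspace_over L V" "card V = card L ^ (2 * r)"
    and B: "B \<subseteq> V" "subspace_over F\<^sub>q B" "card B = card L ^ r" "scattered L B"
    by auto
  have "card L \<ge> q"
    using card_mono[OF finite_class.finite base] card_base by simp
  then have L_gt_1: "card L > 1"
    using q_gt_1 by simp
  have proper: "\<exists>a. a \<notin> W" if "card W = card L ^ i" "i < m" for W :: "'f set" and i
  proof -
    have "card W \<noteq> CARD('f)"
      using that card L_gt_1 by simp
    then show ?thesis by (metis UNIV_eq_I)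
  qed
  \<comment> \<open>Each round uses up two dimensions over \<open>L\<close>; the sizes with
    exponents \<open>2 * r\<close> and \<open>2 * r + 1\<close> leave room since
    \<open>2 * Suc r \<le> m\<close>.\<close>
  obtain a where a: "a \<notin> V"
    using proper[OF V(2)] Suc.prems by auto
  define V1 where "V1 = adjoin L V a"
  have V1: "subspace_over L V1" "card V1 = card L ^ (2 * r + 1)"
    using field_over_itself.subspace_over_adjoin[OF L V(1)]
      field_over_itself.card_adjoin[OF L V(1) a] V(2) by (auto simp: V1_def)
  obtain b where b: "b \<notin> V1"
    using proper[OF V1(2)] Suc.prems by auto
  define V2 where "V2 = adjoin L V1 b"
  have V2: "subspace_over L V2" "card V2 = card L ^ (2 * Suc r)"
    using field_over_itself.subspace_over_adjoin[OF L V1(1)]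
      field_over_itself.card_adjoin[OF L V1(1) b] V1(2) by (auto simp: V2_def)
  \<comment> \<open>The sum V + L a + L b is direct: first the coefficient of \<open>b\<close> is
    read off over \<open>V1\<close>, then that of \<open>a\<close> over \<open>V\<close>.\<close>
  have unique: "v = v' \<and> x = x' \<and> y = y'"
    if "v \<in> V" "v' \<in> V" "x \<in> L" "x' \<in> L" "y \<in> L" "y' \<in> L"
      "v + x * a + y * b = v' + x' * a + y' * b" for v v' x x' y y'
  proof -
    have "v + x * a \<in> V1" "v' + x' * a \<in> V1"
      using that by (auto simp: V1_def intro: field_over_itself.adjoinI)
    then have "v + x * a = v' + x' * a \<and> y = y'"
      using field_over_itself.adjoin_coeff_unique[OF L V1(1) b] that by blast
    then show ?thesis
      using field_over_itself.adjoin_coeff_unique[OF L V(1) a] that by blast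
  qed
  have L_power: "x ^ k \<in> L" if "x \<in> L" for x k
    using that L by (induction k) (auto simp: is_subfield_def)
  have L_mult: "x * y \<in> L" and L_add: "x + y \<in> L" if "x \<in> L" "y \<in> L" for x y
    using that L by (auto simp: is_subfield_def)
  define g where "g = (\<lambda>(v, x). v + x * a + x ^ q * b)"
  define B2 where "B2 = g ` (B \<times> L)"
  have "inj_on g (B \<times> L)"
  proof (rule inj_onI, clarify)
    fix v x w y
    assume "v \<in> B" "x \<in> L" "w \<in> B" "y \<in> L" "g (v, x) = g (w, y)"
    then show "v = w \<and> x = y"
      using unique[of v w x y "x ^ q" "y ^ q"] B(1) L_power by (auto simp: g_def)
  qed
  then have "card B2 = card L ^ Suc r"
    using B(3) by (simp add: B2_def card_image card_cartesian_product)
  moreover have "B2 \<subseteq> V2"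
    using B(1) L_power unfolding B2_def g_def V2_def V1_def
    by (auto intro!: field_over_itself.adjoinI)
  moreover have "subspace_over F\<^sub>q B2"
    unfolding field_over_itself.subspace_over_def
  proof (intro conjI ballI)
    have "0 \<in> B" "0 \<in> L"
      using B(2) L by (auto simp: field_over_itself.subspace_over_def is_subfield_def)
    then show "0 \<in> B2"
      using q_gt_1 unfolding B2_def g_def by (auto intro!: image_eqI[of _ _ "(0, 0)"])
  next
    fix x y assume "x \<in> B2" "y \<in> B2"
    then obtain v c w d where "v \<in> B" "c \<in> L" "w \<in> B" "d \<in> L" "x = g (v, c)" "y = g (w, d)"
      by (auto simp: B2_def)
    moreover from this have "x + y = g (v + w, c + d)"
      by (simp add: g_def frobenius_add algebra_simps)
    ultimately show "x + y \<in> B2"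
      using B(2) L_add unfolding B2_def field_over_itself.subspace_over_def by auto
  next
    fix e x assume e: "e \<in> F\<^sub>q" and "x \<in> B2"
    then obtain v c where "v \<in> B" "c \<in> L" "x = g (v, c)"
      by (auto simp: B2_def)
    \<comment> \<open>The q-power map is linear over F_q, so \<open>g\<close> respects scaling by
      F_q, though in general not by \<open>L\<close>.\<close>
    moreover have "(e * c) ^ q = e * c ^ q"
      using e by (simp only: power_mult_distrib mem_base_iff)
    then have "e * x = g (e * v, e * c)"
      by (simp only: \<open>x = g (v, c)\<close> g_def prod.case distrib_left mult.assoc)
    moreover have "e \<in> L" using base e by (rule subsetD)
    ultimately show "e * x \<in> B2"
      using B(2) e L_mult unfolding B2_def field_over_itself.subspace_over_def by auto
  qed
  moreover have "scattered L B2"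
    unfolding scattered_def
  proof (intro ballI impI)
    fix c z assume c: "c \<in> L" and "z \<in> B2" "z \<noteq> 0" "c * z \<in> B2"
    then obtain v x w y where vx: "v \<in> B" "x \<in> L" "z = g (v, x)"
      and wy: "w \<in> B" "y \<in> L" "c * z = g (w, y)"
      by (auto simp: B2_def)
    \<comment> \<open>Here the L-space \<open>V\<close> around \<open>B\<close> is used: at this
      point \<open>c * v\<close> is only known to lie in \<open>V\<close>, which suffices for
      comparing coefficients.\<close>
    have cv: "c * v \<in> V"
      using V(1) B(1) c vx(1) by (auto simp: field_over_itself.subspace_over_def)
    have "c * v + (c * x) * a + (c * x ^ q) * b = c * z"
      by (simp only: vx(3) g_def prod.case distrib_left mult.assoc)
    also have "\<dots> = w + y * a + y ^ q * b"
      by (simp only: wy(3) g_def prod.case)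
    finally have eq: "c * v = w" "c * x = y" "c * x ^ q = y ^ q"
      using unique[of "c * v" w "c * x" y "c * x ^ q" "y ^ q"] cv B(1) c vx(1,2) wy(1,2) L_mult L_power by auto
    show "c \<in> F\<^sub>q"
    \<comment> \<open>If \<open>x = 0\<close>, then \<open>z = v\<close> and
      \<open>c * z = w\<close> lie in the old \<open>B\<close>, which is scattered by induction;
      otherwise the last two equations give \<open>c ^ q = c\<close>.\<close>
    proof (cases "x = 0")
      case True
      then have "v \<noteq> 0"
        using vx(3) \<open>z \<noteq> 0\<close> q_gt_1 by (auto simp: g_def)
      then show ?thesis
        using B(4) c vx(1) wy(1) eq(1) unfolding scattered_def by blast
    next
      case False
      moreover have "c ^ q * x ^ q = c * x ^ q"
        by (simp only: eq(3) power_mult_distrib[symmetric] eq(2))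
      ultimately have "c ^ q = c"
        by simp
      then show ?thesis
        by (simp add: mem_base_iff)
    qed
  qed
  ultimately show ?case
    using V2 by blast
qed

text \<open>Scatteredness passes to subspaces, so from dimension \<open>d * r\<close> every smaller
  one is reached.\<close>

lemma scattered_subspace_exists:
  assumes "is_subfield L" "F\<^sub>q \<subseteq> L" "card L = q ^ d"
    and "CARD('f) = card L ^ m" "2 * r \<le> m" "s \<le> d * r"
  obtains B where "subspace_over F\<^sub>q B" "card B = q ^ s" "scattered L B"
proof -
  obtain B where B: "subspace_over F\<^sub>q B" "card B = q ^ (d * r)" "scattered L B"
    using scattered_subspace_in_span[OF assms(1,2,4,5)] assms(3) by (auto simp: power_mult)
  from subspace_of_card[OF B(1,2) assms(6)] obtain W where
    W: "W \<subseteq> B" "subspace_over F\<^sub>q W" "card W = q ^ s" by blast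
  moreover have "scattered L W"
    using W(1) B(3) unfolding scattered_def by blast
  ultimately show ?thesis using that by blast
qed

text \<open>By root counting, \<open>L\<close> is the whole root set of X^(q^d) - X, and elements
  fixed by the q-th power are fixed by its iterates.\<close>

lemma base_subset_subfield:
  assumes L: "is_subfield L" and card: "card L = q ^ d" and "d > 0"
  shows "F\<^sub>q \<subseteq> L"
proof -
  have Q: "q ^ d > 1"
    using q_gt_1 \<open>d > 0\<close> by (rule one_less_power)
  have "L = {x. x ^ (q ^ d) + (- 1) * x + 0 = 0}"
  proof (rule card_seteq)
    show "L \<subseteq> {x. x ^ (q ^ d) + (- 1) * x + 0 = 0}"
      using subfield_power_card_eq_same[OF L] card by auto
    show "card {x :: 'f. x ^ (q ^ d) + (- 1) * x + 0 = 0} \<le> card L"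
      unfolding card using Q by (rule card_roots_trinomial)
  qed auto
  moreover have "x ^ (q ^ d) = x" if "x \<in> F\<^sub>q" for x
    using that[unfolded mem_base_iff] by (induction d) (simp_all add: power_mult)
  ultimately show ?thesis by auto
qed

section \<open>Linear sets from products of subspaces\<close>

lemma proj_point_scale:
  assumes "c \<noteq> 0"
  shows "proj_point (c * x, c * y) = proj_point (x, y)"
proof (intro equalityI subsetI)
  fix z assume "z \<in> proj_point (c * x, c * y)"
  then obtain a where "z = (a * (c * x), a * (c * y))"
    by (auto simp: proj_point_eq)
  then show "z \<in> proj_point (x, y)"
    by (auto simp: proj_point_eq intro!: exI[of _ "a * c"])
next
  fix z assume "z \<in> proj_point (x, y)"
  then obtain a where "z = (a * x, a * y)"
    by (auto simp: proj_point_eq)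
  then show "z \<in> proj_point (c * x, c * y)"
    using assms by (auto simp: proj_point_eq intro!: exI[of _ "a / c"])
qed

text \<open>If two nonzero vectors of \<open>A \<times> B\<close> span the same point off the axes,
  the first coordinate confines their ratio to \<open>L\<close> and the second then confines it to
  F_q. The axes cut out \<open>A \<times> {0}\<close> and \<open>{0} \<times> B\<close>.\<close>

lemma linear_set_of_product:
  assumes A: "subspace_over F\<^sub>q A" "card A = q ^ t" and B: "subspace_over F\<^sub>q B" "card B = q ^ s"
    and "0 < t" "0 < s" and L: "is_subfield L" "A \<subseteq> L" "scattered L B"
  obtains P Q where "Fq_subspace_of_dim \<phi> (t + s) (A \<times> B)"
    "P \<in> linear_set (A \<times> B)" "Q \<in> linear_set (A \<times> B)" "P \<noteq> Q"
    "weight \<phi> (A \<times> B) P = t" "weight \<phi> (A \<times> B) Q = s"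
    "\<And>R. R \<in> linear_set (A \<times> B) - {P, Q} \<Longrightarrow> weight \<phi> (A \<times> B) R = 1"
proof
  interpret field_vector_space "scale2 \<phi>"
    unfolding field_vector_space_def by (rule vector_space_scale2) (rule embedding)
  let ?U = "A \<times> B"
  let ?P = "proj_point (1, 0) :: ('f \<times> 'f) set" and ?Q = "proj_point (0, 1) :: ('f \<times> 'f) set"
  \<comment> \<open>All weights are found by counting; \<open>q > 1\<close> makes the exponent
    unique.\<close>
  have dim_eqI: "dim S = k" if "subspace S" "card S = q ^ k" for S :: "('f \<times> 'f) set" and k
    using card_subspace_eq_power_dim[OF that(1)] that(2) q_gt_1 order by simp
  have scale: "\<phi> c * a \<in> A" "\<phi> c * b \<in> B"
    if "a \<in> A" "b \<in> B" for a b c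
    using A(1) B(1) that by (auto simp: field_over_itself.subspace_over_def)
  have zero: "0 \<in> A" "0 \<in> B"
    using A(1) B(1) by (auto simp: field_over_itself.subspace_over_def)
  have U: "subspace ?U"
    using A(1) B(1) by (auto simp: subspace_def field_over_itself.subspace_over_def scale2_def zero_prod_def)
  have "card ?U = q ^ (t + s)"
    using A(2) B(2) by (simp add: card_cartesian_product power_add)
  then show "Fq_subspace_of_dim \<phi> (t + s) ?U"
    unfolding Fq_subspace_of_dim_def using U dim_eqI by blast
  have proj: "subspace (proj_point v)" for v :: "'f \<times> 'f"
    unfolding subspace_def
  proof (intro conjI ballI allI)
    show "0 \<in> proj_point v"
      by (auto simp: proj_point_eq zero_prod_def intro!: exI[of _ 0])
  next
    fix x y assume "x \<in> proj_point v" "y \<in> proj_point v"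
    then obtain a b where "x = (a * fst v, a * snd v)" "y = (b * fst v, b * snd v)"
      by (auto simp: proj_point_eq)
    then show "x + y \<in> proj_point v"
      by (auto simp: proj_point_eq distrib_right intro!: exI[of _ "a + b"])
  next
    fix c x assume "x \<in> proj_point v"
    then obtain a where "x = (a * fst v, a * snd v)"
      by (auto simp: proj_point_eq)
    then show "scale2 \<phi> c x \<in> proj_point v"
      by (auto simp: proj_point_eq scale2_def intro!: exI[of _ "\<phi> c * a"])
  qed
  have weightI: "weight \<phi> ?U (proj_point v) = k" if "card (?U \<inter> proj_point v) = q ^ k" for v k
    unfolding weight_def using that U proj by (intro dim_eqI subspace_inter) auto
  have "?U \<inter> ?P = A \<times> {0}" "?U \<inter> ?Q = {0} \<times> B"
    using zero by (auto simp: proj_point_eq)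
  then show "weight \<phi> ?U ?P = t" "weight \<phi> ?U ?Q = s"
    using A(2) B(2) by (auto intro!: weightI simp: card_cartesian_product)
  have P_eq: "proj_point (a, 0) = ?P" and Q_eq: "proj_point (0, a) = ?Q" if "a \<noteq> 0" for a :: 'f
    using proj_point_scale[OF that, of 1 0] proj_point_scale[OF that, of 0 1] by simp_all
  \<comment> \<open>Positive \<open>t\<close> and \<open>s\<close> supply the nonzero vectors that
    put both axes into the linear set.\<close>
  have "A \<noteq> {0}" "B \<noteq> {0}"
    using A(2) B(2) \<open>0 < t\<close> \<open>0 < s\<close> q_gt_1 one_less_power[of q t] one_less_power[of q s] by auto
  then obtain a b where ab: "a \<in> A" "a \<noteq> 0" "b \<in> B" "b \<noteq> 0"
    using zero by blast
  have "(a, 0) \<in> ?U - {0}" "(0, b) \<in> ?U - {0}"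
    using ab zero by (auto simp: zero_prod_def)
  then show "?P \<in> linear_set ?U" "?Q \<in> linear_set ?U"
    unfolding linear_set_def using P_eq[OF ab(2)] Q_eq[OF ab(4)] by blast+
  have "(1, 0) \<in> ?P" "(1, 0) \<notin> ?Q"
    by (auto simp: proj_point_eq)
  then show "?P \<noteq> ?Q" by metis
  fix R assume R: "R \<in> linear_set ?U - {?P, ?Q}"
  then obtain x y where xy: "x \<in> A" "y \<in> B" "(x, y) \<noteq> 0" "R = proj_point (x, y)"
    by (auto simp: linear_set_def)
  then have "x \<noteq> 0" "y \<noteq> 0"
    using R P_eq[of x] Q_eq[of y] by (auto simp: zero_prod_def)
  have "?U \<inter> R = (\<lambda>c. (c * x, c * y)) ` F\<^sub>q"
  proof (intro equalityI subsetI)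
    fix z assume "z \<in> ?U \<inter> R"
    then obtain c where c: "z = (c * x, c * y)" "c * x \<in> A" "c * y \<in> B"
      by (auto simp: xy(4) proj_point_eq)
    have "(c * x) * inverse x \<in> L"
      using L(1,2) c(2) xy(1) by (auto simp: is_subfield_def)
    moreover have "(c * x) * inverse x = c"
      using \<open>x \<noteq> 0\<close> by simp
    ultimately have "c \<in> L" by simp
    then have "c \<in> F\<^sub>q"
      using L(3) xy(2) \<open>y \<noteq> 0\<close> c(3) unfolding scattered_def by blast
    then show "z \<in> (\<lambda>c. (c * x, c * y)) ` F\<^sub>q"
      using c(1) by blast
  next
    fix z assume "z \<in> (\<lambda>c. (c * x, c * y)) ` F\<^sub>q"
    then show "z \<in> ?U \<inter> R"
      using scale xy by (auto simp: proj_point_eq)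
  qed
  moreover have "inj_on (\<lambda>c. (c * x, c * y)) F\<^sub>q"
    using \<open>x \<noteq> 0\<close> by (auto intro: inj_onI)
  ultimately have "card (?U \<inter> R) = q ^ 1"
    by (simp add: card_image card_base)
  then show "weight \<phi> ?U R = 1"
    unfolding xy(4) by (rule weightI)
qed

text \<open>Common to both parities: \<open>d\<close> is the degree of \<open>L\<close> over F_q and
  \<open>m\<close> that of the field over \<open>L\<close>. The bound \<open>t \<le> d\<close>
  leaves room for \<open>A\<close> in \<open>L\<close>, and \<open>s \<le> d * r\<close> for
  \<open>B\<close> in a scattered space built from \<open>r\<close> pairs of vectors.\<close>

lemma linear_set_from_subfield:
  fixes L :: "'f set"
  assumes "is_subfield L" "card L = q ^ d" "CARD('f) = card L ^ m" "2 * r \<le> m"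
    and "0 < t" "t \<le> d" "0 < s" "s \<le> d * r"
  shows "\<exists>U P Q. Fq_subspace_of_dim \<phi> (t + s) U \<and> P \<in> linear_set U \<and> Q \<in> linear_set U \<and>
    P \<noteq> Q \<and> weight \<phi> U P = t \<and> weight \<phi> U Q = s \<and>
    (\<forall>R\<in>linear_set U - {P, Q}. weight \<phi> U R = 1)"
proof -
  have base: "F\<^sub>q \<subseteq> L"
    using base_subset_subfield[OF assms(1,2)] assms(5,6) by simp
  then have sub: "subspace_over F\<^sub>q L"
    using assms(1) by (auto simp: is_subfield_def field_over_itself.subspace_over_def)
  obtain A where A: "A \<subseteq> L" "subspace_over F\<^sub>q A" "card A = q ^ t"
    using subspace_of_card[OF sub assms(2) \<open>t \<le> d\<close>] by blast
  obtain B where B: "subspace_over F\<^sub>q B" "card B = q ^ s" "scattered L B"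
    using scattered_subspace_exists[OF assms(1) base assms(2-4,8)] by blast
  show ?thesis
    by (rule linear_set_of_product[OF A(2,3) B(1,2) \<open>0 < t\<close> \<open>0 < s\<close> assms(1) A(1) B(3)]) blast
qed

end

section \<open>Choice of the subfield by the parity of n\<close>

theorem theorem4p5:
  fixes \<phi> :: "'q::{field,finite} \<Rightarrow> 'f::{field,finite}"
    and K :: "'f set"
    and q n t l :: nat
  assumes "CARD('q) = q"
    and "CARD('f) = q ^ n"
    and "field_embedding \<phi>"
    and "is_subfield K"
    and "card K = q ^ t"
    and "1 < t" and "t < n"
    and "n = t * l"
  shows "(even n \<longrightarrow> (\<forall>k s. k = t + s \<and> s \<in> {1..n div 2} \<longrightarrow>
            exists_linear_set_with_weights \<phi> k t s))
       \<and> (odd n \<longrightarrow> (\<forall>k s. k = t + s \<and> s \<in> {1..(n - t) div 2} \<longrightarrow>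
            exists_linear_set_with_weights \<phi> k t s))
       \<and> (even n \<and> t = n div 2 \<longrightarrow>
            (\<exists>U. Fq_subspace_of_dim \<phi> n U \<and>
               card {P \<in> linear_set U. weight \<phi> U P > 1} = 2 \<and>
               (\<forall>P\<in>linear_set U. weight \<phi> U P > 1 \<longrightarrow> weight \<phi> U P = n div 2)))"
proof -
  interpret ext: finite_field_extension \<phi> q
    by unfold_locales fact+
  have "l \<ge> 2"
    using assms(6-8) by (cases l; cases "l - 1") auto
  have even_case: "\<exists>U P Q. Fq_subspace_of_dim \<phi> (t + s) U \<and> P \<in> linear_set U \<and> Q \<in> linear_set U \<and>
      P \<noteq> Q \<and> weight \<phi> U P = t \<and> weight \<phi> U Q = s \<and>
      (\<forall>R\<in>linear_set U - {P, Q}. weight \<phi> U R = 1)"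
    if "even n" and s: "s \<in> {1..n div 2}" for s
  proof -
    obtain d where n: "n = 2 * d" using \<open>even n\<close> by blast
    \<comment> \<open>As a proper divisor of \<open>n\<close>, \<open>t\<close> is at most
      \<open>n / 2\<close>, so a \<open>t\<close>-dimensional \<open>A\<close> fits into the
      half-degree field.\<close>
    have "2 * t \<le> n"
      using \<open>l \<ge> 2\<close> assms(8) by simp
    then have "t \<le> d" using n by simp
    obtain L :: "'f set" where L: "is_subfield L" "card L = q ^ d"
      using ext.half_degree_subfield[of d] assms(1,2) n \<open>t \<le> d\<close> \<open>1 < t\<close> by auto
    have "CARD('f) = card L ^ 2"
      using L(2) assms(1,2) n by (simp add: power_mult mult.commute)
    \<comment> \<open>Over \<open>L\<close> the field is a plane, with room for one pair of vectors;
      hence \<open>s\<close> may go up to \<open>d = n / 2\<close>.\<close>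
    from ext.linear_set_from_subfield[OF L this, of 1 t s] show ?thesis
      using s n \<open>1 < t\<close> \<open>t \<le> d\<close> by simp
  qed
  have odd_case: "exists_linear_set_with_weights \<phi> (t + s) t s"
    if "odd n" and s: "s \<in> {1..(n - t) div 2}" for s
  proof -
    \<comment> \<open>For odd \<open>n\<close> the degree \<open>l\<close> over \<open>K\<close> is
      odd, and \<open>(n - t) div 2 = t * r\<close> is the dimension reached with \<open>r\<close>
      pairs over \<open>K\<close>.\<close>
    obtain r where l: "l = 2 * r + 1"
      using \<open>odd n\<close> assms(8) by (auto elim: oddE)
    then have "s \<le> t * r"
      using s assms(8) by (simp add: algebra_simps)
    moreover have "card K = q ^ t" "CARD('f) = card K ^ l"
      using assms by (simp_all add: power_mult)
    ultimately show ?thesis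
      using ext.linear_set_from_subfield[OF assms(4), of t l r t s] s l \<open>1 < t\<close>
      unfolding exists_linear_set_with_weights_def Bex_def by (simp del: split_paired_Ex)
  qed
  have "\<exists>U. Fq_subspace_of_dim \<phi> n U \<and> card {P \<in> linear_set U. weight \<phi> U P > 1} = 2 \<and>
      (\<forall>P\<in>linear_set U. weight \<phi> U P > 1 \<longrightarrow> weight \<phi> U P = n div 2)"
    if "even n" and t: "t = n div 2"
  proof -
    \<comment> \<open>The even case with \<open>s = t = n / 2\<close>: the rank becomes
      \<open>n\<close>, and since \<open>t > 1\<close> the two special points are exactly those of
      weight above one.\<close>
    have "t + t = n" using that by auto
    then obtain U P Q where U: "Fq_subspace_of_dim \<phi> n U" "P \<in> linear_set U" "Q \<in> linear_set U"
      "P \<noteq> Q" "weight \<phi> U P = t" "weight \<phi> U Q = t"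
      "\<forall>R\<in>linear_set U - {P, Q}. weight \<phi> U R = 1"
      using even_case[OF \<open>even n\<close>, of t] t \<open>1 < t\<close> by auto
    have "R \<in> {P, Q}" if "R \<in> linear_set U" "weight \<phi> U R > 1" for R
      using U(7) that by (metis DiffI less_irrefl)
    moreover have "weight \<phi> U P > 1" "weight \<phi> U Q > 1"
      using U(5,6) \<open>1 < t\<close> by simp_all
    ultimately have "{P \<in> linear_set U. weight \<phi> U P > 1} = {P, Q}"
      using U(2,3) by blast
    then show ?thesis
      using U t by (intro exI[of _ U]) auto
  qed
  moreover have "exists_linear_set_with_weights \<phi> (t + s) t s" if "even n" "s \<in> {1..n div 2}" for s
    using even_case[OF that] unfolding exists_linear_set_with_weights_def Bex_def
    by (simp del: split_paired_Ex)
  ultimately show ?thesis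
    using odd_case by blast
qed

end
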